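(* Let $m\ge 2$ be an integer. For every integer $n\ge 2$, \[ q_B(C_{2n}\square P_m)=4. \] For every integer $n\ge 1$, \[ q_B(C_{2n+1}\square P_m)= \begin{cases} 4,&2\le m\le n,\\ 5,&m\ge n+1. \end{cases} \]
   Context: All graphs are finite and simple. An edge-coloring is proper if incident (i.e. sharing an endpoint) distinct edges receive distinct colors. A set of edges is rainbow if its edges have pairwise distinct colors. A B-coloring of a graph $G$ is a proper edge-coloring of $G$ in which every $4$-cycle (cycle subgraph of length $4$, not necessarily induced) is rainbow. The B-coloring number $q_B(G)$ is the minimum number of colors in a B-coloring of $G$. $P_n$ and $C_n$ denote the path and the cycle on $n$ vertices. The Cartesian product $G\square H$ has vertex set $V(G)\times V(H)$, with $(u,x)$ adjacent to $(v,y)$ if and only if $uv\in E(G)$ and $x=y$, or $u=v$ and $xy\in E(H)$. *)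

theory Defs
  imports Main
begin

text \<open>A graph is a pair of a vertex set and a set of edges, each edge being the two-element set
  of its endpoints.\<close>

type_synonym 'a graph = "'a set \<times> 'a set set"

abbreviation verts :: "'a graph \<Rightarrow> 'a set" where "verts \<equiv> fst"
abbreviation edges :: "'a graph \<Rightarrow> 'a set set" where "edges \<equiv> snd"

definition finite_simple_graph :: "'a graph \<Rightarrow> bool" where
  "finite_simple_graph G \<longleftrightarrow>
     finite (verts G) \<and> (\<forall>e \<in> edges G. e \<subseteq> verts G \<and> card e = 2)"

definition path_graph :: "nat \<Rightarrow> nat graph" where
  "path_graph n = ({..<n}, {{i, Suc i} | i. Suc i < n})"

text \<open>This is the usual cycle graph only for \<open>n \<ge> 3\<close>.\<close>

definition cycle_graph :: "nat \<Rightarrow> nat graph" where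
  "cycle_graph n = ({..<n}, {{i, Suc i mod n} | i. i < n})"

definition cartesian_product :: "'a graph \<Rightarrow> 'b graph \<Rightarrow> ('a \<times> 'b) graph" where
  "cartesian_product G H =
     (verts G \<times> verts H,
      {{(u, x), (v, y)} | u x v y.
         u \<in> verts G \<and> v \<in> verts G \<and> x \<in> verts H \<and> y \<in> verts H \<and>
         ({u, v} \<in> edges G \<and> x = y \<or> u = v \<and> {x, y} \<in> edges H)})"

definition proper_edge_coloring :: "'a graph \<Rightarrow> ('a set \<Rightarrow> nat) \<Rightarrow> bool" where
  "proper_edge_coloring G c \<longleftrightarrow>
     (\<forall>e \<in> edges G. \<forall>f \<in> edges G. e \<noteq> f \<and> e \<inter> f \<noteq> {} \<longrightarrow> c e \<noteq> c f)"

definition rainbow :: "('a set \<Rightarrow> nat) \<Rightarrow> 'a set set \<Rightarrow> bool" where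
  "rainbow c F \<longleftrightarrow> (\<forall>e \<in> F. \<forall>f \<in> F. e \<noteq> f \<longrightarrow> c e \<noteq> c f)"

text \<open>The edge sets of the (not necessarily induced) cycle subgraphs of length 4.\<close>

definition four_cycles :: "'a graph \<Rightarrow> 'a set set set" where
  "four_cycles G =
     {{{w, x}, {x, y}, {y, z}, {z, w}} | w x y z.
        distinct [w, x, y, z] \<and>
        {w, x} \<in> edges G \<and> {x, y} \<in> edges G \<and> {y, z} \<in> edges G \<and> {z, w} \<in> edges G}"

definition B_coloring :: "'a graph \<Rightarrow> ('a set \<Rightarrow> nat) \<Rightarrow> bool" where
  "B_coloring G c \<longleftrightarrow>
     proper_edge_coloring G c \<and> (\<forall>F \<in> four_cycles G. rainbow c F)"

text \<open>Only the colors that occur on edges of \<open>G\<close> are counted. The minimum exists for every finite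
  simple graph by \<open>q_B_attained\<close> below; natural numbers provide enough colors since \<open>G\<close> is finite.\<close>

definition q_B :: "'a graph \<Rightarrow> nat" where
  "q_B G = (LEAST k. \<exists>c. B_coloring G c \<and> card (c ` edges G) = k)"

lemma finite_edges:
  assumes "finite_simple_graph G"
  shows "finite (edges G)"
  using assms unfolding finite_simple_graph_def
  by (meson Pow_iff finite_Pow_iff rev_finite_subset subsetI)

lemma q_B_attained:
  assumes "finite_simple_graph G"
  shows "\<exists>c. B_coloring G c \<and> card (c ` edges G) = q_B G"
proof -
  obtain c :: "'a set \<Rightarrow> nat" where c: "inj_on c (edges G)"
    using finite_imp_inj_to_nat_seg[OF finite_edges[OF assms]] by blast
  have "B_coloring G c"
    using c unfolding B_coloring_def proper_edge_coloring_def rainbow_def four_cycles_def inj_on_def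
    by blast
  then have "\<exists>k c. B_coloring G c \<and> card (c ` edges G) = k" by blast
  then show ?thesis unfolding q_B_def by (rule LeastI_ex)
qed

lemma finite_simple_path_graph: "finite_simple_graph (path_graph n)"
  by (auto simp: finite_simple_graph_def path_graph_def)

lemma finite_simple_cycle_graph:
  assumes "3 \<le> n"
  shows "finite_simple_graph (cycle_graph n)"
proof -
  have "i \<noteq> Suc i mod n" if "i < n" for i
    using that assms by (cases "Suc i = n") auto
  then show ?thesis
    using assms by (auto simp: finite_simple_graph_def cycle_graph_def card_2_iff)
qed

lemma finite_simple_cartesian_product:
  assumes "finite_simple_graph G" and "finite_simple_graph H"
  shows "finite_simple_graph (cartesian_product G H)"
  using assms
  by (fastforce simp: finite_simple_graph_def cartesian_product_def card_insert_if split: if_splits)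

end

(* Write H i j for the color of the edge from (i, j) to (i + 1, j) and V i j for that of the edge
   from (i, j) to (i, j + 1). With only four colors, the edges around an inner vertex and those around
   a square each use every color once. This is rigid along diagonals: if the two neighbors of an edge
   on a diagonal have different colors (a defect), then the same holds for the adjacent parallel
   diagonal, so that the defect travels through all levels along the other diagonal direction, and
   defects of the two directions cannot meet. If a diagonal has no defect at the bottom level, the pair
   of its colors there is the complement of the pair on the preceding diagonal; hence on a cycle of
   odd length a single defect cannot restore the pattern, and there are at least two of either
   direction. On 2n + 1 columns, four such defects can avoid each other on at most n levels. *)

theory Submission
  imports Defs "HOL-Number_Theory.Cong"
begin

section \<open>Edges and 4-cycles of the cylinder\<close>

abbreviation cylinder :: "nat \<Rightarrow> nat \<Rightarrow> (nat \<times> nat) graph" where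
  "cylinder k m \<equiv> cartesian_product (cycle_graph k) (path_graph m)"

definition hedge :: "nat \<Rightarrow> nat \<Rightarrow> nat \<Rightarrow> (nat \<times> nat) set" where
  "hedge k i j = {(i, j), (Suc i mod k, j)}"

definition vedge :: "nat \<Rightarrow> nat \<Rightarrow> (nat \<times> nat) set" where
  "vedge i j = {(i, j), (i, Suc j)}"

lemma Suc_mod_eq_if: "i < k \<Longrightarrow> Suc i mod k = (if Suc i = k then 0 else Suc i)"
  by (simp add: mod_Suc)

lemma edges_cylinder:
  "edges (cylinder k m) = {hedge k i j | i j. i < k \<and> j < m} \<union> {vedge i j | i j. i < k \<and> Suc j < m}"
  (is "?L = ?R")
proof -
  have mem: "e \<in> ?L \<longleftrightarrow> (\<exists>u x v y. e = {(u, x), (v, y)} \<and> u < k \<and> v < k \<and> x < m \<and> y < m \<and>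
      ((\<exists>i. {u, v} = {i, Suc i mod k} \<and> i < k) \<and> x = y
        \<or> u = v \<and> (\<exists>j. {x, y} = {j, Suc j} \<and> Suc j < m)))" for e
    by (simp only: cartesian_product_def cycle_graph_def path_graph_def fst_conv snd_conv
        mem_Collect_eq lessThan_iff)
  show ?thesis
  proof (intro set_eqI iffI)
    fix e assume "e \<in> ?L"
    then show "e \<in> ?R"
      unfolding mem
    proof (elim exE conjE)
      fix u x v y
      assume e: "e = {(u, x), (v, y)}" and le: "u < k" "x < m"
        and adj: "(\<exists>i. {u, v} = {i, Suc i mod k} \<and> i < k) \<and> x = y
             \<or> u = v \<and> (\<exists>j. {x, y} = {j, Suc j} \<and> Suc j < m)"
      from adj show "e \<in> ?R"
      proof
        assume "(\<exists>i. {u, v} = {i, Suc i mod k} \<and> i < k) \<and> x = y"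
        then obtain i where i: "{u, v} = {i, Suc i mod k}" "i < k" and xy: "x = y" by blast
        have "e = (\<lambda>a. (a, x)) ` {u, v}" unfolding e xy by simp
        then have "e = hedge k i x" unfolding i hedge_def by simp
        then show ?thesis using i le by blast
      next
        assume "u = v \<and> (\<exists>j. {x, y} = {j, Suc j} \<and> Suc j < m)"
        then obtain j where j: "{x, y} = {j, Suc j}" "Suc j < m" and uv: "u = v" by blast
        have "e = Pair u ` {x, y}" unfolding e uv by simp
        then have "e = vedge u j" unfolding j vedge_def by simp
        then show ?thesis using j le by blast
      qed
    qed
  next
    fix e assume "e \<in> ?R"
    then consider i j where "e = hedge k i j" "i < k" "j < m"
      | i j where "e = vedge i j" "i < k" "Suc j < m" by blast
    then show "e \<in> ?L"
    proof cases
      case (1 i j)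
      show ?thesis
        unfolding mem
        by (rule exI[of _ i], rule exI[of _ j], rule exI[of _ "Suc i mod k"], rule exI[of _ j])
          (use 1 in \<open>auto simp: hedge_def\<close>)
    next
      case (2 i j)
      show ?thesis
        unfolding mem
        by (rule exI[of _ i], rule exI[of _ j], rule exI[of _ i], rule exI[of _ "Suc j"])
          (use 2 in \<open>auto simp: vedge_def\<close>)
    qed
  qed
qed

lemma hedge_in_cylinder: "i < k \<Longrightarrow> j < m \<Longrightarrow> hedge k i j \<in> edges (cylinder k m)"
  and vedge_in_cylinder: "i < k \<Longrightarrow> Suc j < m \<Longrightarrow> vedge i j \<in> edges (cylinder k m)"
  unfolding edges_cylinder by blast+

text \<open>The bound \<open>3 \<le> k\<close> matters: on two columns, the horizontal edges
  starting at columns 0 and 1 of a level coincide.\<close>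

lemma hedge_eq_iff:
  assumes "3 \<le> k" "i < k" "i' < k"
  shows "hedge k i j = hedge k i' j' \<longleftrightarrow> i = i' \<and> j = j'"
  unfolding hedge_def Suc_mod_eq_if[OF assms(2)] Suc_mod_eq_if[OF assms(3)]
  using assms(1) by (auto simp: doubleton_eq_iff split: if_splits)

lemma vedge_eq_iff: "vedge i j = vedge i' j' \<longleftrightarrow> i = i' \<and> j = j'"
  by (auto simp: vedge_def doubleton_eq_iff)

lemma hedge_neq_vedge: "hedge k i j \<noteq> vedge i' j'"
  by (auto simp: hedge_def vedge_def doubleton_eq_iff)

text \<open>Every pair of incident horizontal and vertical edges lies on a common square, so that
  the condition on squares covers it.\<close>

definition cylinder_coloring :: "nat \<Rightarrow> nat \<Rightarrow> (nat \<Rightarrow> nat \<Rightarrow> 'c) \<Rightarrow> (nat \<Rightarrow> nat \<Rightarrow> 'c) \<Rightarrow> bool" where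
  "cylinder_coloring k m H V \<longleftrightarrow>
     (\<forall>i<k. \<forall>j<m. H i j \<noteq> H (Suc i mod k) j \<and> (k = 4 \<longrightarrow> H i j \<noteq> H ((i + 2) mod 4) j)) \<and>
     (\<forall>i<k. \<forall>j. Suc j < m \<longrightarrow> distinct [H i j, H i (Suc j), V i j, V (Suc i mod k) j]) \<and>
     (\<forall>i<k. \<forall>j. Suc (Suc j) < m \<longrightarrow> V i j \<noteq> V i (Suc j))"

text \<open>\<open>rainbow\<close> speaks of a set of edges, so the list form requires the four
  edges to be pairwise different; this follows from the distinctness of the vertices.\<close>

lemma distinct_colors_of_four_cycle:
  assumes B: "B_coloring G c" and d: "distinct [w, x, y, z]"
    and E: "{w, x} \<in> edges G" "{x, y} \<in> edges G" "{y, z} \<in> edges G" "{z, w} \<in> edges G"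
  shows "distinct [c {w, x}, c {x, y}, c {y, z}, c {z, w}]"
proof -
  let ?F = "{{w, x}, {x, y}, {y, z}, {z, w}}"
  have "?F \<in> four_cycles G" unfolding four_cycles_def using d E by blast
  with B have r: "rainbow c ?F" unfolding B_coloring_def by blast
  have "{w, x} \<noteq> {x, y}" "{w, x} \<noteq> {y, z}" "{w, x} \<noteq> {z, w}"
    "{x, y} \<noteq> {y, z}" "{x, y} \<noteq> {z, w}" "{y, z} \<noteq> {z, w}"
    using d by (auto simp: doubleton_eq_iff)
  with r show ?thesis unfolding rainbow_def by simp
qed

lemma cylinder_coloring_of_B_coloring:
  assumes B: "B_coloring (cylinder k m) c" and k: "3 \<le> k"
  shows "cylinder_coloring k m (\<lambda>i j. c (hedge k i j)) (\<lambda>i j. c (vedge i j))"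
proof -
  have proper: "c e \<noteq> c f"
    if "e \<in> edges (cylinder k m)" "f \<in> edges (cylinder k m)" "e \<noteq> f" "e \<inter> f \<noteq> {}" for e f
    using B that unfolding B_coloring_def proper_edge_coloring_def by blast
  have row: "c (hedge k i j) \<noteq> c (hedge k (Suc i mod k) j)" if "i < k" "j < m" for i j
  proof (rule proper)
    show "hedge k i j \<noteq> hedge k (Suc i mod k) j"
      using that k by (auto simp: hedge_eq_iff Suc_mod_eq_if)
    show "hedge k i j \<inter> hedge k (Suc i mod k) j \<noteq> {}" by (simp add: hedge_def)
  qed (use that in \<open>auto intro: hedge_in_cylinder\<close>)
  \<comment> \<open>For \<open>k = 4\<close> every row is itself a 4-cycle. The map \<open>v\<close>
    walks around it from column \<open>i\<close>, and the edges leaving \<open>v 0\<close> and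
    \<open>v 2\<close> are opposite.\<close>
  have row4: "c (hedge k i j) \<noteq> c (hedge k ((i + 2) mod 4) j)" if "i < k" "j < m" "k = 4" for i j
  proof -
    define v where "v a = ((i + a) mod 4, j)" for a
    have e: "{v a, v (Suc a)} = hedge k ((i + a) mod 4) j" for a
      using that by (simp add: v_def hedge_def mod_simps)
    have E: "{v a, v (Suc a)} \<in> edges (cylinder k m)" for a
      unfolding e using that by (simp add: hedge_in_cylinder)
    have three: "Suc 2 = 3" by simp
    have v4: "v 4 = v 0" by (simp add: v_def)
    have "distinct [c {v 0, v 1}, c {v 1, v 2}, c {v 2, v 3}, c {v 3, v 0}]"
    proof (rule distinct_colors_of_four_cycle[OF B])
      have "i \<in> {0, 1, 2, 3}" using that by auto
      then show "distinct [v 0, v 1, v 2, v 3]" by (auto simp: v_def)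
    qed (use E[of 0] E[of 1] E[of 2] E[of 3] v4 in \<open>simp_all add: numeral_eq_Suc\<close>)
    moreover have "{v 0, v 1} = hedge k i j" using e[of 0] that by simp
    moreover have "{v 2, v 3} = hedge k ((i + 2) mod 4) j" using e[of 2] unfolding three .
    ultimately show ?thesis by simp
  qed
  have square: "distinct [c (hedge k i j), c (hedge k i (Suc j)), c (vedge i j), c (vedge (Suc i mod k) j)]"
    if "i < k" "Suc j < m" for i j
  proof -
    let ?s = "Suc i mod k"
    have s: "?s < k" "?s \<noteq> i" using that k by (auto simp: Suc_mod_eq_if)
    have e: "{(i, j), (?s, j)} = hedge k i j" "{(?s, j), (?s, Suc j)} = vedge ?s j"
      "{(?s, Suc j), (i, Suc j)} = hedge k i (Suc j)" "{(i, Suc j), (i, j)} = vedge i j"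
      by (auto simp: hedge_def vedge_def)
    have "distinct [c {(i, j), (?s, j)}, c {(?s, j), (?s, Suc j)},
      c {(?s, Suc j), (i, Suc j)}, c {(i, Suc j), (i, j)}]"
      by (rule distinct_colors_of_four_cycle[OF B], unfold e)
        (use that s in \<open>auto intro: hedge_in_cylinder vedge_in_cylinder\<close>)
    then show ?thesis unfolding e by auto
  qed
  have column: "c (vedge i j) \<noteq> c (vedge i (Suc j))" if "i < k" "Suc (Suc j) < m" for i j
  proof (rule proper)
    show "vedge i j \<in> edges (cylinder k m)" "vedge i (Suc j) \<in> edges (cylinder k m)"
      using that by (auto intro: vedge_in_cylinder)
    show "vedge i j \<noteq> vedge i (Suc j)" by (simp add: vedge_eq_iff)
    show "vedge i j \<inter> vedge i (Suc j) \<noteq> {}" by (simp add: vedge_def)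
  qed
  show ?thesis
    unfolding cylinder_coloring_def using row row4 square column by blast
qed

text \<open>Each edge changes exactly one coordinate and no vertex repeats, so a 4-cycle is a square
  or winds once around a row, which forces \<open>k = 4\<close>. Only one pair of opposite edges is
  reported: rotating the cycle gives the other one, and incident edges are a matter of
  properness.\<close>

lemma four_cycle_in_cylinder:
  assumes "distinct [w, x, y, z]" and k: "3 \<le> k"
    and E: "{w, x} \<in> edges (cylinder k m)" "{x, y} \<in> edges (cylinder k m)"
      "{y, z} \<in> edges (cylinder k m)" "{z, w} \<in> edges (cylinder k m)"
  obtains i j where "i < k" "Suc j < m" "{{w, x}, {y, z}} = {hedge k i j, hedge k i (Suc j)}"
  | i j where "i < k" "Suc j < m" "{{w, x}, {y, z}} = {vedge i j, vedge (Suc i mod k) j}"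
  | i j where "k = 4" "i < k" "j < m" "{{w, x}, {y, z}} = {hedge k i j, hedge k ((i + 2) mod 4) j}"
proof -
  define next_to where "next_to i i' \<longleftrightarrow> i < k \<and> i' < k \<and> (i' = Suc i mod k \<or> i = Suc i' mod k)" for i i'
  have irrefl: "\<not> next_to i i" for i
    using k Suc_mod_eq_if[of i k] by (auto simp: next_to_def split: if_splits)
  have adj: "snd u < m \<and> snd v < m \<and> (snd u = snd v \<and> next_to (fst u) (fst v) \<or>
     fst u < k \<and> fst u = fst v \<and> (snd v = Suc (snd u) \<or> snd u = Suc (snd v)))"
    if "{u, v} \<in> edges (cylinder k m)" for u v
  proof -
    from that consider i j where "{u, v} = {(i, j), (Suc i mod k, j)}" "i < k" "j < m"
      | i j where "{u, v} = {(i, j), (i, Suc j)}" "i < k" "Suc j < m"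
      unfolding edges_cylinder hedge_def vedge_def by blast
    then show ?thesis
    proof cases
      case (1 i j)
      then have "next_to i (Suc i mod k)" "next_to (Suc i mod k) i" by (auto simp: next_to_def)
      with 1 show ?thesis by (auto simp: doubleton_eq_iff)
    next
      case 2
      then show ?thesis by (auto simp: doubleton_eq_iff)
    qed
  qed
  obtain w1 w2 x1 x2 y1 y2 z1 z2 where c: "w = (w1, w2)" "x = (x1, x2)" "y = (y1, y2)" "z = (z1, z2)"
    by (cases w, cases x, cases y, cases z)
  note a = E[THEN adj, unfolded c fst_conv snd_conv]
  have d: "\<not> (w1 = y1 \<and> w2 = y2)" "\<not> (x1 = z1 \<and> x2 = z2)"
    using assms(1) unfolding c by auto
  have shape: "next_to w1 x1 \<and> next_to x1 y1 \<and> next_to y1 z1 \<and> next_to z1 w1 \<and> w2 = x2 \<and> x2 = y2 \<and> y2 = z2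
    \<or> next_to w1 x1 \<and> y1 = x1 \<and> z1 = w1 \<and> x2 = w2 \<and> z2 = y2 \<and> (y2 = Suc w2 \<or> w2 = Suc y2)
    \<or> next_to x1 y1 \<and> x1 = w1 \<and> z1 = y1 \<and> y2 = x2 \<and> w2 = z2 \<and> (x2 = Suc w2 \<or> w2 = Suc x2)"
  proof -
    have flat: "w2 = x2 \<Longrightarrow> next_to w1 x1" "x2 = y2 \<Longrightarrow> next_to x1 y1" "y2 = z2 \<Longrightarrow> next_to y1 z1"
      "z2 = w2 \<Longrightarrow> next_to z1 w1"
      using a by linarith+
    have steep: "w2 \<noteq> x2 \<Longrightarrow> w1 = x1 \<and> (x2 = Suc w2 \<or> w2 = Suc x2)"
      "x2 \<noteq> y2 \<Longrightarrow> x1 = y1 \<and> (y2 = Suc x2 \<or> x2 = Suc y2)"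
      "y2 \<noteq> z2 \<Longrightarrow> y1 = z1 \<and> (z2 = Suc y2 \<or> y2 = Suc z2)"
      "z2 \<noteq> w2 \<Longrightarrow> z1 = w1 \<and> (w2 = Suc z2 \<or> z2 = Suc w2)"
      using a by blast+
    have ne: "w2 = x2 \<Longrightarrow> w1 \<noteq> x1" "x2 = y2 \<Longrightarrow> x1 \<noteq> y1" "y2 = z2 \<Longrightarrow> y1 \<noteq> z1" "z2 = w2 \<Longrightarrow> z1 \<noteq> w1"
      using flat irrefl by metis+
    show ?thesis
    proof (cases "w2 = x2")
      case True
      show ?thesis
      proof (cases "x2 = y2")
        case True
        then have "y2 = z2" using \<open>w2 = x2\<close> d steep(3,4) by metis
        then show ?thesis using \<open>w2 = x2\<close> True flat by simp
      next
        case False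
        then have "y2 \<noteq> z2 \<Longrightarrow> z2 \<noteq> w2" using \<open>w2 = x2\<close> d steep(2,3) by metis
        then have "y2 = z2" using \<open>w2 = x2\<close> False ne(1) steep by metis
        then show ?thesis using \<open>w2 = x2\<close> False flat steep by metis
      qed
    next
      case False
      show ?thesis
      proof (cases "x2 = y2")
        case True
        then have "y2 = z2 \<Longrightarrow> False" using False d steep ne flat by metis
        then have "z2 = w2" using False True d steep ne flat by metis
        then show ?thesis using False True steep flat by metis
      next
        case False
        \<comment> \<open>Two vertical edges in succession put \<open>w\<close> and \<open>y\<close>
          two levels apart in one column. The only way back in two edges leads through
          \<open>x\<close>, contrary to \<open>x \<noteq> z\<close>.\<close>
        then have "w1 = y1" using \<open>w2 \<noteq> x2\<close> steep by metis
        then have two: "y2 = Suc (Suc w2) \<or> w2 = Suc (Suc y2)"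
          using steep(1)[OF \<open>w2 \<noteq> x2\<close>] steep(2)[OF False] d(1) by auto
        have "y2 = z2 \<Longrightarrow> False" using two \<open>w1 = y1\<close> steep(4) ne(3) by auto
        then have z: "z1 = x1" "y2 \<noteq> z2" using steep(2,3) False by metis+
        have "w2 \<noteq> z2" using ne(4) z \<open>w1 = y1\<close> steep(2) False by metis
        then have "w2 = Suc z2 \<or> z2 = Suc w2" using steep(4) by metis
        then have "z2 = x2"
          using two steep(1)[OF \<open>w2 \<noteq> x2\<close>] steep(2)[OF False] steep(3)[OF z(2)] by presburger
        then show ?thesis using z d(2) by simp
      qed
    qed
  qed
  then consider (row) "next_to w1 x1 \<and> next_to x1 y1 \<and> next_to y1 z1 \<and> next_to z1 w1 \<and> w2 = x2 \<and> x2 = y2 \<and> y2 = z2"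
    | (horizontal) "next_to w1 x1 \<and> y1 = x1 \<and> z1 = w1 \<and> x2 = w2 \<and> z2 = y2 \<and> (y2 = Suc w2 \<or> w2 = Suc y2)"
    | (vertical) "next_to x1 y1 \<and> x1 = w1 \<and> z1 = y1 \<and> y2 = x2 \<and> w2 = z2 \<and> (x2 = Suc w2 \<or> w2 = Suc x2)"
    by blast
  then show thesis
  proof cases
    case row
    then have row: "w2 = x2" "x2 = y2" "y2 = z2"
      and n: "next_to w1 x1" "next_to x1 y1" "next_to y1 z1" "next_to z1 w1" by blast+
    from n have lt: "w1 < k" "x1 < k" "y1 < k" "z1 < k" unfolding next_to_def by blast+
    from d row have ne: "w1 \<noteq> y1" "x1 \<noteq> z1" by auto
    have inj: "a = b" if "Suc a mod k = Suc b mod k" "a < k" "b < k" for a b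
      using that(1) unfolding Suc_mod_eq_if[OF that(2)] Suc_mod_eq_if[OF that(3)]
      by (auto split: if_splits)
    \<comment> \<open>Four successor steps return to the start, so \<open>k\<close> divides
      4.\<close>
    have around: "k = 4 \<and> b = Suc a mod 4 \<and> p = (a + 2) mod 4 \<and> q = (Suc a + 2) mod 4"
      if b: "b = Suc a mod k" and p: "p = Suc b mod k" and q: "q = Suc p mod k"
        and a: "a = Suc q mod k" "a < k" for a b p q
    proof -
      have p': "p = (a + 2) mod k" unfolding p b by (simp add: mod_simps)
      have q': "q = (Suc a + 2) mod k" unfolding q p' by (simp add: mod_simps)
      have "Suc q mod k = (a + 4) mod k" unfolding q' by (simp add: mod_simps numeral_eq_Suc)
      then have "(a + 4) mod k = a mod k" using a by (metis mod_less)
      then have "k dvd 4" using mod_eq_dvd_iff_nat[of a "a + 4" k] by simp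
      then have "k \<le> 4" "k \<noteq> 3" by (auto dest: dvd_imp_le)
      then have "k = 4" using k by simp
      then show ?thesis using b p' q' by blast
    qed
    \<comment> \<open>Opposite vertices differ, so the cycle never turns back; the two disjuncts are
      the two directions of traversal.\<close>
    have "k = 4 \<and> x1 = Suc w1 mod 4 \<and> y1 = (w1 + 2) mod 4 \<and> z1 = (Suc w1 + 2) mod 4
      \<or> k = 4 \<and> w1 = Suc x1 mod 4 \<and> z1 = (x1 + 2) mod 4 \<and> y1 = (Suc x1 + 2) mod 4"
    proof (cases "x1 = Suc w1 mod k")
      case True
      then have "y1 = Suc x1 mod k" using n(2) ne lt inj[of w1 y1] unfolding next_to_def by metis
      moreover from this have "z1 = Suc y1 mod k" using n(3) ne lt inj[of x1 z1] unfolding next_to_def by metis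
      moreover from this have "w1 = Suc z1 mod k" using n(4) ne lt inj[of y1 w1] unfolding next_to_def by metis
      ultimately show ?thesis using around[of x1 w1 y1 z1] True lt by blast
    next
      case False
      then have w: "w1 = Suc x1 mod k" using n(1) unfolding next_to_def by blast
      then have "z1 = Suc w1 mod k" using n(4) ne lt inj[of x1 z1] unfolding next_to_def by metis
      moreover from this have "y1 = Suc z1 mod k" using n(3) ne lt inj[of w1 y1] unfolding next_to_def by metis
      moreover from this have "x1 = Suc y1 mod k" using n(2) ne lt inj[of z1 x1] unfolding next_to_def by metis
      ultimately show ?thesis using around[of w1 x1 z1 y1] w lt by blast
    qed
    then consider "k = 4" "x1 = Suc w1 mod 4" "y1 = (w1 + 2) mod 4" "z1 = (Suc w1 + 2) mod 4"
      | "k = 4" "w1 = Suc x1 mod 4" "z1 = (x1 + 2) mod 4" "y1 = (Suc x1 + 2) mod 4" by blast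
    then show thesis
    proof cases
      case 1
      show ?thesis
        by (rule that(3)[of w1 w2])
          (use 1 row a(1) lt in \<open>auto simp: c hedge_def mod_simps insert_commute\<close>)
    next
      case 2
      show ?thesis
        by (rule that(3)[of x1 w2])
          (use 2 row a(1) lt in \<open>auto simp: c hedge_def mod_simps insert_commute\<close>)
    qed
  next
    case horizontal
    then have s: "next_to w1 x1" "y1 = x1" "z1 = w1" "x2 = w2" "z2 = y2" and r: "y2 = Suc w2 \<or> w2 = Suc y2"
      by blast+
    from s(1) obtain i where "i < k" "{w1, x1} = {i, Suc i mod k}"
      unfolding next_to_def by (metis insert_commute)
    moreover have "w2 < m" "y2 < m" using a by blast+
    with r obtain j where "Suc j < m" "{w2, y2} = {j, Suc j}" by (metis insert_commute)
    ultimately show thesis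
      by (intro that(1)[of i j]) (use s in \<open>auto simp: c hedge_def doubleton_eq_iff insert_commute\<close>)
  next
    case vertical
    then have s: "next_to x1 y1" "x1 = w1" "z1 = y1" "y2 = x2" "w2 = z2" and r: "x2 = Suc w2 \<or> w2 = Suc x2"
      by blast+
    from s(1) obtain i where "i < k" "{x1, y1} = {i, Suc i mod k}"
      unfolding next_to_def by (metis insert_commute)
    moreover have "w2 < m" "x2 < m" using a by blast+
    with r obtain j where "Suc j < m" "{w2, x2} = {j, Suc j}" by (metis insert_commute)
    ultimately show thesis
      by (intro that(2)[of i j]) (use s in \<open>auto simp: c vedge_def doubleton_eq_iff insert_commute\<close>)
  qed
qed

lemma B_coloring_of_cylinder_coloring:
  fixes H V :: "nat \<Rightarrow> nat \<Rightarrow> nat"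
  assumes cc: "cylinder_coloring k m H V" and k: "3 \<le> k"
    and HN: "\<And>i j. i < k \<Longrightarrow> j < m \<Longrightarrow> H i j < N" and VN: "\<And>i j. i < k \<Longrightarrow> Suc j < m \<Longrightarrow> V i j < N"
  shows "\<exists>c. B_coloring (cylinder k m) c \<and> card (c ` edges (cylinder k m)) \<le> N"
proof -
  \<comment> \<open>This is well defined because an edge with \<open>i < k\<close> determines its
    kind and both of its indices.\<close>
  define c where "c e = (THE q. \<exists>i j. i < k \<and> (e = hedge k i j \<and> q = H i j \<or> e = vedge i j \<and> q = V i j))" for e
  have ch: "c (hedge k i j) = H i j" if "i < k" for i j
    unfolding c_def using that k by (intro the_equality) (auto simp: hedge_eq_iff hedge_neq_vedge)
  have cv: "c (vedge i j) = V i j" if "i < k" for i j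
    unfolding c_def using that k
    by (intro the_equality) (auto simp: vedge_eq_iff hedge_neq_vedge[symmetric])
  have row: "H i j \<noteq> H (Suc i mod k) j" and row4: "k = 4 \<Longrightarrow> H i j \<noteq> H ((i + 2) mod 4) j"
    if "i < k" "j < m" for i j
    using cc that unfolding cylinder_coloring_def by blast+
  have square: "distinct [H i j, H i (Suc j), V i j, V (Suc i mod k) j]" if "i < k" "Suc j < m" for i j
    using cc that unfolding cylinder_coloring_def by blast
  have column: "V i j \<noteq> V i (Suc j)" if "i < k" "Suc (Suc j) < m" for i j
    using cc that unfolding cylinder_coloring_def by blast
  have hh: "H i j \<noteq> H i' j'"
    if "i < k" "i' < k" "j < m" "hedge k i j \<inter> hedge k i' j' \<noteq> {}" "hedge k i j \<noteq> hedge k i' j'" for i j i' j'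
  proof -
    from that(4,5) have "j = j'" "i' = Suc i mod k \<or> i = Suc i' mod k"
      using k unfolding hedge_def Suc_mod_eq_if[OF that(1)] Suc_mod_eq_if[OF that(2)]
      by (auto split: if_splits)
    then show ?thesis using row[of i j] row[of i' j'] that by auto
  qed
  have hv: "H i j \<noteq> V i' j'"
    if "i < k" "i' < k" "j < m" "Suc j' < m" "hedge k i j \<inter> vedge i' j' \<noteq> {}" for i j i' j'
  proof -
    from that have "j = j' \<or> j = Suc j'" "i' = i \<or> i' = Suc i mod k"
      by (auto simp: hedge_def vedge_def)
    then show ?thesis using square[of i j'] that by auto
  qed
  have vv: "V i j \<noteq> V i' j'"
    if "i < k" "Suc j < m" "Suc j' < m" "vedge i j \<inter> vedge i' j' \<noteq> {}" "vedge i j \<noteq> vedge i' j'" for i j i' j'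
  proof -
    from that have "i = i'" "j' = Suc j \<or> j = Suc j'" by (auto simp: vedge_def)
    then show ?thesis using column[of i j] column[of i' j'] that by auto
  qed
  have proper: "proper_edge_coloring (cylinder k m) c"
    unfolding proper_edge_coloring_def
  proof (intro ballI impI, elim conjE)
    fix e f assume "e \<in> edges (cylinder k m)" "f \<in> edges (cylinder k m)" and ne: "e \<noteq> f" "e \<inter> f \<noteq> {}"
    then consider
      i j i' j' where "e = hedge k i j" "i < k" "j < m" "f = hedge k i' j'" "i' < k" "j' < m"
    | i j i' j' where "e = hedge k i j" "i < k" "j < m" "f = vedge i' j'" "i' < k" "Suc j' < m"
    | i j i' j' where "e = vedge i j" "i < k" "Suc j < m" "f = hedge k i' j'" "i' < k" "j' < m"
    | i j i' j' where "e = vedge i j" "i < k" "Suc j < m" "f = vedge i' j'" "i' < k" "Suc j' < m"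
      unfolding edges_cylinder by blast
    then show "c e \<noteq> c f"
    proof cases
      case 1 then show ?thesis using hh ne by (simp add: ch)
    next
      case 2 then show ?thesis using hv ne by (simp add: ch cv)
    next
      case (3 i j i' j') then show ?thesis using hv[of i' i j' j] ne by (simp add: ch cv Int_commute)
    next
      case 4 then show ?thesis using vv ne by (simp add: cv)
    qed
  qed
  \<comment> \<open>Properness covers incident edges, so only opposite edges of a 4-cycle
    remain.\<close>
  have opposite: "c {w, x} \<noteq> c {y, z}"
    if d: "distinct [w, x, y, z]" and E: "{w, x} \<in> edges (cylinder k m)" "{x, y} \<in> edges (cylinder k m)"
      "{y, z} \<in> edges (cylinder k m)" "{z, w} \<in> edges (cylinder k m)" for w x y z
    using d k E
  proof (cases rule: four_cycle_in_cylinder)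
    case (1 i j)
    then show ?thesis using square[of i j] by (auto simp: ch doubleton_eq_iff)
  next
    case (2 i j)
    then show ?thesis using square[of i j] by (auto simp: cv doubleton_eq_iff)
  next
    case (3 i j)
    then have "c (hedge k i j) \<noteq> c (hedge k ((i + 2) mod 4) j)"
      using row4[of i j] ch[of i j] ch[of "(i + 2) mod 4" j] by simp
    with 3(4) show ?thesis by (auto simp: doubleton_eq_iff)
  qed
  have "rainbow c F" if "F \<in> four_cycles (cylinder k m)" for F
  proof -
    from that obtain w x y z where F: "F = {{w, x}, {x, y}, {y, z}, {z, w}}"
      and d: "distinct [w, x, y, z]" and E: "{w, x} \<in> edges (cylinder k m)"
        "{x, y} \<in> edges (cylinder k m)" "{y, z} \<in> edges (cylinder k m)" "{z, w} \<in> edges (cylinder k m)"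
      unfolding four_cycles_def by blast
    have incident: "c {p, q} \<noteq> c {q, r}"
      if "{p, q} \<in> edges (cylinder k m)" "{q, r} \<in> edges (cylinder k m)" "p \<noteq> r" "p \<noteq> q" for p q r
    proof -
      from that have "{p, q} \<noteq> {q, r}" by (auto simp: doubleton_eq_iff)
      moreover have "{p, q} \<inter> {q, r} \<noteq> {}" by simp
      ultimately show ?thesis
        using proper[unfolded proper_edge_coloring_def, rule_format, OF that(1,2)] by (simp only: simp_thms)
    qed
    have "c {w, x} \<noteq> c {x, y}" "c {x, y} \<noteq> c {y, z}" "c {y, z} \<noteq> c {z, w}" "c {z, w} \<noteq> c {w, x}"
      using incident[of w x y] incident[of x y z] incident[of y z w] incident[of z w x] d E by auto
    moreover have "c {w, x} \<noteq> c {y, z}" "c {x, y} \<noteq> c {z, w}"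
      using opposite[of w x y z] opposite[of x y z w] d E by auto
    ultimately show ?thesis unfolding F rainbow_def by (simp add: eq_commute)
  qed
  with proper have "B_coloring (cylinder k m) c" unfolding B_coloring_def by blast
  moreover have "c ` edges (cylinder k m) \<subseteq> {..<N}"
    unfolding edges_cylinder using HN VN by (auto simp: ch cv)
  then have "card (c ` edges (cylinder k m)) \<le> N"
    by (metis card_lessThan card_mono finite_lessThan)
  ultimately show ?thesis by blast
qed

section \<open>Four colors on an odd cylinder\<close>

text \<open>In the applications \<open>a\<close>, \<open>b\<close>, \<open>c\<close>,
  \<open>d\<close> are the colors of the edges meeting an edge of color \<open>v\<close>, for which
  three colors are left. The inequalities rule out every coincidence except the two diagonal
  ones.\<close>

lemma rainbow_quadruple:
  assumes "card C = 4" and "{a, b, c, d, v} \<subseteq> C" and "v \<notin> {a, b, c, d}"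
    and "a \<noteq> b" "c \<noteq> d" "a \<noteq> c" "b \<noteq> d"
  shows "a = d \<or> b = c"
proof (rule ccontr)
  assume "\<not> (a = d \<or> b = c)"
  then have "card {a, b, c, d, v} = 5" using assms by auto
  moreover have "finite C" using assms(1) card.infinite by fastforce
  ultimately show False using card_mono[of C "{a, b, c, d, v}"] assms(1,2) by simp
qed

text \<open>As \<open>p \<noteq> r\<close>, the colors \<open>p\<close>, \<open>q\<close>,
  \<open>r\<close>, \<open>t\<close> exhaust \<open>C\<close>, which forces the remaining color of
  each block. In the applications one block surrounds a square and the other an inner vertex, and
  they share the edges colored \<open>q\<close> and \<open>t\<close>.\<close>

lemma rainbow_blocks:
  assumes "card C = 4" and "{p, q, r, s, t, u} \<subseteq> C" and "distinct [p, q, s, t]" and "distinct [q, r, t, u]"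
    and "p \<noteq> r"
  shows "s = r" and "u = p"
proof -
  have fin: "finite C" using assms(1) card.infinite by fastforce
  have "{p, q, r, t} = C"
    by (rule card_subset_eq[OF fin]) (use assms in auto)
  with assms show "s = r" "u = p" by auto
qed

text \<open>Columns are indexed by all integers and colored periodically, so that the reflection
  \<open>i \<mapsto> - i\<close> exchanges the two diagonal directions without boundary cases.\<close>

locale four_colored_cylinder =
  fixes C :: "'c set" and k m :: nat and H V :: "int \<Rightarrow> nat \<Rightarrow> 'c"
  assumes card_C: "card C = 4" and odd_k: "odd k"
    and H_in: "j < m \<Longrightarrow> H i j \<in> C" and V_in: "Suc j < m \<Longrightarrow> V i j \<in> C"
    and H_mod: "H (i mod int k) j = H i j" and V_mod: "V (i mod int k) j = V i j"
    and row: "j < m \<Longrightarrow> H i j \<noteq> H (i + 1) j"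
    and column: "Suc (Suc j) < m \<Longrightarrow> V i j \<noteq> V i (Suc j)"
    and square: "Suc j < m \<Longrightarrow> distinct [H i j, H i (Suc j), V i j, V (i + 1) j]"
begin

text \<open>Column \<open>i\<close> goes to column \<open>- i\<close>, so the horizontal edge from
  \<open>i\<close> to \<open>i + 1\<close> goes to the one starting at \<open>- i - 1\<close>; hence
  the extra shift for \<open>H\<close>. Facts about rising diagonals thereby apply to falling
  ones.\<close>

lemma reflect: "four_colored_cylinder C k m (\<lambda>i. H (- i - 1)) (\<lambda>i. V (- i))"
proof
  show "distinct [H (- i - 1) j, H (- i - 1) (Suc j), V (- i) j, V (- (i + 1)) j]" if "Suc j < m" for i j
    using square[of j "- i - 1"] that by auto
  show "H (- i - 1) j \<noteq> H (- (i + 1) - 1) j" if "j < m" for i j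
  proof -
    have "- (i + 1) - 1 + 1 = - i - 1" by simp
    then show ?thesis using row[OF that, of "- (i + 1) - 1"] by metis
  qed
  show "H (- (i mod int k) - 1) j = H (- i - 1) j" for i j
    by (metis H_mod mod_diff_left_eq mod_minus_eq)
  show "V (- (i mod int k)) j = V (- i) j" for i j
    by (metis V_mod mod_minus_eq)
qed (simp_all add: card_C odd_k H_in V_in column)

text \<open>A defect is a non-alternating triple on a rising diagonal, with central edge \<open>V i j\<close>.\<close>

definition defect :: "int \<Rightarrow> nat \<Rightarrow> bool" where
  "defect i j \<longleftrightarrow> H (i - 1) j \<noteq> H i (Suc j)"

section \<open>Propagation, number and crossing of defects\<close>

lemma defect_mod: "[i = i'] (mod int k) \<Longrightarrow> defect i j \<longleftrightarrow> defect i' j"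
  unfolding defect_def cong_def by (metis H_mod mod_diff_left_eq)

text \<open>The blocks are the square with lower left corner \<open>(i - 1, j)\<close> and the edges
  at its upper right corner \<open>(i, Suc j)\<close>, an inner vertex.\<close>

lemma defect_row:
  assumes "defect i j" "Suc (Suc j) < m"
  shows "V (i - 1) j = H i (Suc j)" "V i (Suc j) = H (i - 1) j"
proof -
  have "V (i - 1) j = H i (Suc j) \<and> V i (Suc j) = H (i - 1) j"
    using rainbow_blocks[OF card_C, of "H (i - 1) j" "V i j" "H i (Suc j)" "V (i - 1) j"
      "H (i - 1) (Suc j)" "V i (Suc j)"] square[of j "i - 1"] square[of j i] square[of "Suc j" "i - 1"]
      square[of "Suc j" i] row[of "Suc j" "i - 1"] column[of j i] assms
    by (auto simp: H_in V_in defect_def)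
  then show "V (i - 1) j = H i (Suc j)" "V i (Suc j) = H (i - 1) j" by blast+
qed

text \<open>The first claim is the intermediate stage: a non-alternating triple on the adjacent
  parallel diagonal, with central edge \<open>H (i - 1) (Suc j)\<close>. The second one reaches the
  next vertical central edge, one column to the left and one level up.\<close>

lemma defect_up:
  assumes "defect i j" "Suc (Suc j) < m"
  shows "V (i - 1) j \<noteq> V i (Suc j)" "defect (i - 1) (Suc j)"
proof -
  show *: "V (i - 1) j \<noteq> V i (Suc j)" using defect_row[OF assms] assms(1) by (simp add: defect_def)
  \<comment> \<open>Here the blocks are the edges at the vertex \<open>(i - 1, Suc j)\<close> and
    the square with this lower left corner.\<close>
  show "defect (i - 1) (Suc j)"
    using rainbow_blocks[OF card_C, of "V (i - 1) j" "H (i - 1) (Suc j)" "V i (Suc j)" 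
      "H (i - 2) (Suc j)" "V (i - 1) (Suc j)" "H (i - 1) (Suc (Suc j))"]
      square[of j "i - 1"] square[of j "i - 2"] square[of "Suc j" "i - 1"] square[of "Suc j" "i - 2"]
      row[of "Suc j" "i - 2"] column[of j "i - 1"] assms *
    by (auto simp: H_in V_in defect_def)
qed

lemma defect_shift: "defect i 0 \<Longrightarrow> Suc j < m \<Longrightarrow> defect (i - int j) j"
proof (induction j)
  case (Suc j)
  then show ?case using defect_up(2)[of "i - int j" j] by (simp add: algebra_simps)
qed simp

text \<open>The exempted column \<open>p\<close> makes the lemma yield two incongruent defects when
  it is applied a second time with the first defect as \<open>p\<close>.\<close>

lemma ex_defect:
  assumes m: "2 \<le> m"
  shows "\<exists>i. defect i 0 \<and> \<not> [i = p] (mod int k)"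
proof (rule ccontr)
  assume none: "\<nexists>i. defect i 0 \<and> \<not> [i = p] (mod int k)"
  define S where "S i = {H i 0, V (i + 1) 0}" for i
  \<comment> \<open>Without a defect at \<open>i\<close>, the color \<open>H (i - 1) 0\<close>
    recurs on the top edge of the square on columns \<open>i\<close> and \<open>i + 1\<close>. So
    \<open>S (i - 1)\<close> and \<open>S i\<close> are the two halves of this rainbow
    square.\<close>
  have flip: "S i = C - S (i - 1)" if "\<not> [i = p] (mod int k)" for i
  proof -
    have "H (i - 1) 0 = H i 1" using none that unfolding defect_def by auto
    moreover have "{H i 0, H i 1, V i 0, V (i + 1) 0} = C"
      by (rule card_subset_eq) (use square[of 0 i] H_in V_in m card_C card.infinite[of C] in auto)
    ultimately show ?thesis using square[of 0 i] m unfolding S_def by auto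
  qed
  obtain n where n: "k = 2 * n + 1" using odd_k by (elim oddE)
  \<comment> \<open>Two complementations cancel, and none of the steps to \<open>p + 1\<close>, ...,
    \<open>p + 2 * n\<close> uses the exempted column.\<close>
  have "S (p + 2 * int t) = S p" if "t \<le> n" for t
    using that
  proof (induction t)
    case (Suc t)
    have "\<not> [p + 2 * int t + s = p] (mod int k)" if "s \<in> {1, 2}" for s
      using Suc.prems that zdvd_imp_le[of "int k" "2 * int t + s"] by (auto simp: cong_iff_dvd_diff n)
    from flip[OF this[of 1]] flip[OF this[of 2]]
    have "S (p + 2 * int (Suc t)) = C - (C - S (p + 2 * int t))" by (simp add: algebra_simps)
    moreover have "S (p + 2 * int t) \<subseteq> C" unfolding S_def using H_in V_in m by auto
    ultimately show ?case using Suc by auto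
  qed simp
  from this[of n] have "S (p + 2 * int n) = S p" by simp
  \<comment> \<open>As \<open>k = 2 * n + 1\<close>, the walk ends just before \<open>p\<close>; but
    \<open>S (p - 1)\<close> and \<open>S p\<close> differ in \<open>V p 0\<close>.\<close>
  moreover have "S (p + 2 * int n) = S (p - 1)"
  proof -
    have "(p + 2 * int n) mod int k = (p - 1) mod int k" "(p + 2 * int n + 1) mod int k = (p - 1 + 1) mod int k"
      by (simp_all add: n mod_eq_dvd_iff add.commute)
    then show ?thesis unfolding S_def by (metis H_mod V_mod)
  qed
  moreover have "V p 0 \<in> S (p - 1)" unfolding S_def by simp
  moreover have "V p 0 \<notin> S p" unfolding S_def using square[of 0 p] m by auto
  ultimately show False by blast
qed

text \<open>The two equations fail exactly at a rising and at a falling defect with central edge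
  \<open>V i j\<close>; both at once would need five colors.\<close>

lemma no_crossing_at_vertical:
  assumes "Suc j < m"
  shows "H (i - 1) j = H i (Suc j) \<or> H i j = H (i - 1) (Suc j)"
  by (rule rainbow_quadruple[OF card_C, of _ _ _ _ "V i j"])
    (use assms square[of j i] square[of j "i - 1"] row[of j "i - 1"] row[of "Suc j" "i - 1"] in
      \<open>auto simp: H_in V_in\<close>)

text \<open>The same argument for the intermediate stages, where the two diagonals cross at the
  horizontal edge \<open>H i (Suc j)\<close>.\<close>

lemma no_crossing_at_horizontal:
  assumes "Suc (Suc j) < m"
  shows "V i j = V (i + 1) (Suc j) \<or> V (i + 1) j = V i (Suc j)"
  by (rule rainbow_quadruple[OF card_C, of _ _ _ _ "H i (Suc j)"])
    (use assms square[of j i] square[of "Suc j" i] column[of j i] column[of j "i + 1"] in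
      \<open>auto simp: H_in V_in\<close>)

lemma too_many_levels:
  assumes k: "k = 2 * n + 1" and n: "1 \<le> n" and m: "m = n + 1"
  shows False
proof -
  interpret R: four_colored_cylinder C k m "\<lambda>i. H (- i - 1)" "\<lambda>i. V (- i)"
    by (rule reflect)
  \<comment> \<open>At level \<open>j\<close> the rising defect is at column \<open>p - j\<close>
    and the falling one at \<open>j - q\<close>. They meet on a vertical edge if
    \<open>p + q\<close> is congruent to \<open>2 * j\<close>, and on the horizontal edge above if
    it is congruent to \<open>2 * j + 1\<close>. On \<open>n + 1\<close> levels this excludes all
    residues up to \<open>2 * n - 2\<close>.\<close>
  have far: "(p + q) mod int k \<in> {2 * int n - 1, 2 * int n}"
    if p: "defect p 0" and q: "R.defect q 0" for p q
  proof (rule ccontr)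
    define r where "r = nat ((p + q) mod int k)"
    have r: "int r = (p + q) mod int k" unfolding r_def using k by simp
    assume "(p + q) mod int k \<notin> {2 * int n - 1, 2 * int n}"
    then have "int r \<noteq> 2 * int n - 1" "int r \<noteq> 2 * int n" unfolding r by auto
    moreover have "int r < int k" unfolding r using k by simp
    ultimately have small: "r + 2 \<le> 2 * n" using k by linarith
    have "[int r = p + q] (mod int k)" unfolding cong_def r by simp
    then have dvd: "int k dvd int r - (p + q)" by (simp add: cong_iff_dvd_diff)
    obtain j where "r = 2 * j \<or> r = 2 * j + 1" by (metis oddE evenE)
    then show False
    proof
      assume rj: "r = 2 * j"
      then have j: "Suc j < m" using small m by simp
      have "[q - int j = int j - p] (mod int k)"
        using dvd unfolding cong_iff_dvd_diff by (subst dvd_minus_iff[symmetric]) (simp add: rj algebra_simps)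
      then have "R.defect (int j - p) j" using R.defect_shift[OF q j] R.defect_mod by blast
      then have "H (p - int j) j \<noteq> H (p - int j - 1) (Suc j)"
        unfolding R.defect_def by (simp add: algebra_simps)
      then show False
        using defect_shift[OF p j] no_crossing_at_vertical[OF j, of "p - int j"] unfolding defect_def by blast
    next
      assume rj: "r = 2 * j + 1"
      then have j: "Suc (Suc j) < m" using small m by simp
      have "[q - int j = int j + 1 - p] (mod int k)"
        using dvd unfolding cong_iff_dvd_diff by (subst dvd_minus_iff[symmetric]) (simp add: rj algebra_simps)
      then have "R.defect (int j + 1 - p) j" using R.defect_shift[OF q Suc_lessD[OF j]] R.defect_mod by blast
      from R.defect_up(1)[OF this j] have "V (p - int j) j \<noteq> V (p - int j - 1) (Suc j)"
        by (simp add: algebra_simps)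
      then show False
        using defect_up(1)[OF defect_shift[OF p Suc_lessD[OF j]] j] no_crossing_at_horizontal[OF j, of "p - int j - 1"]
        by simp
    qed
  qed
  have m2: "2 \<le> m" using m n by simp
  obtain p where p: "defect p 0" using ex_defect[OF m2] by blast
  obtain p' where p': "defect p' 0" "\<not> [p' = p] (mod int k)" using ex_defect[OF m2] by blast
  obtain q where q: "R.defect q 0" using R.ex_defect[OF m2] by blast
  obtain q' where q': "R.defect q' 0" "\<not> [q' = q] (mod int k)" using R.ex_defect[OF m2] by blast
  \<comment> \<open>Changing one of the two defects changes the residue of the sum, and only two
    consecutive residues are allowed. So the alternating sum of the four residues is 2 or -2,
    although it is divisible by the odd number \<open>k \<ge> 3\<close>.\<close>
  let ?s = "\<lambda>x y. (x + y) mod int k"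
  have "?s p q \<noteq> ?s p' q" "?s p q \<noteq> ?s p q'" "?s p' q' \<noteq> ?s p q'" "?s p' q' \<noteq> ?s p' q"
    using p'(2) q'(2) by (auto simp: cong_def mod_eq_dvd_iff algebra_simps dvd_diff_commute)
  then have "?s p q + ?s p' q' \<noteq> ?s p q' + ?s p' q"
    and "\<bar>(?s p q + ?s p' q') - (?s p q' + ?s p' q)\<bar> = 2"
    using far[OF p q] far[OF p q'(1)] far[OF p'(1) q] far[OF p'(1) q'(1)] by auto
  moreover have "int k dvd (?s p q + ?s p' q') - (?s p q' + ?s p' q)"
    unfolding mod_eq_dvd_iff[symmetric] mod_add_eq by (simp add: ac_simps)
  ultimately have "int k dvd 2" by (metis dvd_abs_iff)
  then show False using zdvd_imp_le[of "int k" 2] k n by simp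
qed

end

lemma no_four_coloring:
  assumes B: "B_coloring (cylinder (2 * n + 1) m) c" and n: "1 \<le> n" and m: "n + 1 \<le> m"
  shows "card (c ` edges (cylinder (2 * n + 1) m)) \<noteq> 4"
proof
  let ?k = "2 * n + 1"
  let ?G = "cylinder ?k m"
  assume card: "card (c ` edges ?G) = 4"
  define col where "col i = nat (i mod int ?k)" for i
  have col: "col i < ?k" "col (i mod int ?k) = col i" "Suc (col i) mod ?k = col (i + 1)" for i
  proof -
    show "col i < ?k" unfolding col_def by (simp add: nat_less_iff)
    show "col (i mod int ?k) = col i" unfolding col_def by simp
    have "int (Suc (col i) mod ?k) = (i mod int ?k + 1) mod int ?k"
      unfolding col_def by (simp add: zmod_int add.commute)
    also have "\<dots> = int (col (i + 1))" unfolding col_def by (simp add: mod_simps)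
    finally show "Suc (col i) mod ?k = col (i + 1)" by simp
  qed
  have k3: "3 \<le> ?k" using n by simp
  note cc = cylinder_coloring_of_B_coloring[OF B k3, unfolded cylinder_coloring_def]
  \<comment> \<open>The coloring is unrolled to integer columns by \<open>col\<close> and restricted
    to the lowest \<open>n + 1\<close> levels, the height that \<open>too_many_levels\<close>
    refutes.\<close>
  have "four_colored_cylinder (c ` edges ?G) ?k (n + 1) (\<lambda>i j. c (hedge ?k (col i) j)) (\<lambda>i j. c (vedge (col i) j))"
  proof
    show "c (hedge ?k (col i) j) \<noteq> c (hedge ?k (col (i + 1)) j)" if "j < n + 1" for i j
      using cc col[of i] that m by (metis less_le_trans)
    show "c (vedge (col i) j) \<noteq> c (vedge (col i) (Suc j))" if "Suc (Suc j) < n + 1" for i j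
      using cc col[of i] that m by (metis less_le_trans)
    show "distinct [c (hedge ?k (col i) j), c (hedge ?k (col i) (Suc j)), c (vedge (col i) j), c (vedge (col (i + 1)) j)]"
      if "Suc j < n + 1" for i j
      using cc col[of i] that m by (metis less_le_trans)
    show "c (hedge ?k (col i) j) \<in> c ` edges ?G" if "j < n + 1" for i j
      using col(1) that m by (intro imageI hedge_in_cylinder) auto
    show "c (vedge (col i) j) \<in> c ` edges ?G" if "Suc j < n + 1" for i j
      using col(1) that m by (intro imageI vedge_in_cylinder) auto
  qed (simp_all only: col card, simp)
  then show False by (rule four_colored_cylinder.too_many_levels) (use n in auto)
qed

section \<open>Colorings\<close>

text \<open>Colorings are given in sheared coordinates: \<open>r\<close> is the column plus the
  level modulo \<open>k\<close>, so that going right and going up both increase \<open>r\<close> by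
  one. A pattern that ignores \<open>j\<close> is then constant along the direction in which rising
  defects travel.\<close>

lemma q_B_cylinder_le:
  fixes h v :: "nat \<Rightarrow> nat \<Rightarrow> nat"
  assumes k: "3 \<le> k"
    and row: "\<And>r j. r < k \<Longrightarrow> j < m \<Longrightarrow> h r j \<noteq> h (Suc r mod k) j"
    and row4: "\<And>r j. k = 4 \<Longrightarrow> r < 4 \<Longrightarrow> h r j \<noteq> h ((r + 2) mod 4) j"
    and square: "\<And>r j. r < k \<Longrightarrow> Suc j < m \<Longrightarrow>
      distinct [h r j, h (Suc r mod k) (Suc j), v r j, v (Suc r mod k) j]"
    and column: "\<And>r j. r < k \<Longrightarrow> Suc (Suc j) < m \<Longrightarrow> v r j \<noteq> v (Suc r mod k) (Suc j)"
    and less: "\<And>r j. r < k \<Longrightarrow> h r j < N" "\<And>r j. r < k \<Longrightarrow> v r j < N"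
  shows "q_B (cylinder k m) \<le> N"
proof -
  define H where "H i j = h ((i + j) mod k) j" for i j
  define V where "V i j = v ((i + j) mod k) j" for i j
  have lt: "(i + j) mod k < k" for i j using k by simp
  have next_col: "(Suc i mod k + j) mod k = Suc ((i + j) mod k) mod k"
    and next_level: "(i + Suc j) mod k = Suc ((i + j) mod k) mod k" for i j
    by (simp_all add: mod_simps)
  have "cylinder_coloring k m H V"
    unfolding cylinder_coloring_def H_def V_def next_col next_level
  proof (intro conjI allI impI)
    fix i j :: nat assume "k = 4"
    have "((i + 2) mod 4 + j) mod 4 = ((i + j) mod 4 + 2) mod 4"
      unfolding mod_add_left_eq by (simp add: ac_simps)
    with row4[OF \<open>k = 4\<close>, of "(i + j) mod 4" j] \<open>k = 4\<close>
    show "h ((i + j) mod k) j \<noteq> h (((i + 2) mod 4 + j) mod k) j" by simp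
  qed (use row square column lt in \<open>blast+\<close>)
  from B_coloring_of_cylinder_coloring[OF this k, of N]
  obtain c where c: "B_coloring (cylinder k m) c" "card (c ` edges (cylinder k m)) \<le> N"
    unfolding H_def V_def using less lt by blast
  then have "q_B (cylinder k m) \<le> card (c ` edges (cylinder k m))"
    unfolding q_B_def by (intro Least_le) blast
  with c show ?thesis by linarith
qed

lemma q_B_even_cylinder_le:
  assumes "2 \<le> n"
  shows "q_B (cylinder (2 * n) m) \<le> 4"
\<comment> \<open>For \<open>n = 2\<close> the rows are 4-cycles, on which alternating horizontal
  colors would repeat on opposite edges. A cyclic pattern of all four colors takes their
  place.\<close>
proof (cases "n = 2")
  case True
  have r: "r \<in> {0, 1, 2, 3}" if "r < 4" for r :: nat using that by auto
  have "q_B (cylinder 4 m) \<le> 4"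
    by (rule q_B_cylinder_le[where h = "\<lambda>r j. r" and v = "\<lambda>r j. (r + 2) mod 4"])
      (auto dest!: r)
  then show ?thesis using True by simp
next
  case False
  show ?thesis
    by (rule q_B_cylinder_le[where h = "\<lambda>r j. if even r then 0 else 1" and
          v = "\<lambda>r j. if even r then 2 else 3"])
      (use assms False in \<open>auto simp: dvd_mod_iff\<close>)
qed

text \<open>A band of columns, widening by two per level, in which the colors \<open>{0, 1}\<close> and \<open>{2, 3}\<close> of
  horizontal and vertical edges are interchanged; it must not close up around the cylinder.\<close>

lemma q_B_odd_cylinder_le_4:
  assumes "2 \<le> m" "m \<le> n"
  shows "q_B (cylinder (2 * n + 1) m) \<le> 4"
  by (rule q_B_cylinder_le[where
        h = "\<lambda>r j. (if even r then 0 else 1) + (if r \<le> 2 * j + 1 then 0 else 2)" and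
        v = "\<lambda>r j. (if even r then 1 else 0) + (if r \<le> 2 * j + 2 then 2 else 0)"])
    (use assms in \<open>auto simp: Suc_mod_eq_if split: if_splits\<close>)

text \<open>An explicit pattern with period 3 in the levels: the outer lists are indexed by the
  level modulo 3, the inner ones by the sheared column. All conditions reduce to finitely many
  residues.\<close>

lemma q_B_triangular_cylinder_le: "q_B (cylinder 3 m) \<le> 5"
proof -
  have r: "r \<in> {0, 1, 2}" if "r < 3" for r :: nat using that by auto
  have j: "j mod 3 = 0 \<and> Suc j mod 3 = 1 \<or> j mod 3 = 1 \<and> Suc j mod 3 = 2
      \<or> j mod 3 = 2 \<and> Suc j mod 3 = 0" for j :: nat
    by presburger
  let ?h = "\<lambda>r j. [[0, 1, 2], [4, 3, 0], [3, 1, 2]] ! (j mod 3) ! r :: nat"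
  let ?v = "\<lambda>r j. [[1, 2, 3], [2, 0, 1], [4, 0, 3]] ! (j mod 3) ! r :: nat"
  show ?thesis
  proof (rule q_B_cylinder_le[where h = ?h and v = ?v])
    fix r j :: nat assume "r < 3"
    note cases = r[OF this] j[of j]
    show "?h r j \<noteq> ?h (Suc r mod 3) j" using cases by auto
    show "distinct [?h r j, ?h (Suc r mod 3) (Suc j), ?v r j, ?v (Suc r mod 3) j]" using cases by auto
    show "?v r j \<noteq> ?v (Suc r mod 3) (Suc j)" using cases by auto
    show "?h r j < 5" "?v r j < 5" using cases by auto
  qed auto
qed

text \<open>The pairs \<open>{h r, v r}\<close> form a closed walk of odd length in the Petersen graph, whose vertices
  are the 2-subsets of \<open>{0..4}\<close> and whose edges join disjoint subsets. Its girth is 5, so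
  this is not possible for \<open>n = 1\<close>.\<close>

lemma q_B_odd_cylinder_le_5:
  assumes "1 \<le> n"
  shows "q_B (cylinder (2 * n + 1) m) \<le> 5"
proof (cases "n = 1")
  case True
  then show ?thesis using q_B_triangular_cylinder_le[of m] by simp
next
  case False
  \<comment> \<open>The walk alternates between \<open>{0, 1}\<close> and \<open>{2, 3}\<close> and
    closes through \<open>{0, 4}\<close>, \<open>{1, 2}\<close>, \<open>{3, 4}\<close> back to
    \<open>{0, 1}\<close>.\<close>
  define h where "h r = (if r + 2 < 2 * n then (if even r then 0 else 2)
    else if r + 2 = 2 * n then 4 else if r + 1 = 2 * n then 1 else 3 :: nat)" for r
  define v where "v r = (if r + 2 < 2 * n then (if even r then 1 else 3)
    else if r + 2 = 2 * n then 0 else if r + 1 = 2 * n then 2 else 4 :: nat)" for r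
  have disjoint: "distinct [h r, h (Suc r mod (2 * n + 1)), v r, v (Suc r mod (2 * n + 1))]"
    if "r < 2 * n + 1" for r
  proof -
    have "r + 3 < 2 * n \<or> r + 3 = 2 * n \<or> r + 2 = 2 * n \<or> r + 1 = 2 * n \<or> r = 2 * n"
      using that by linarith
    \<comment> \<open>The alternating part ends with \<open>{2, 3}\<close>, which is disjoint from
      \<open>{0, 4}\<close>.\<close>
    moreover have "odd r" if "r + 3 = 2 * n"
      using that by presburger
    ultimately show ?thesis
      using assms False by (elim disjE) (simp_all add: Suc_mod_eq_if h_def v_def)
  qed
  show ?thesis
  proof (rule q_B_cylinder_le[where h = "\<lambda>r j. h r" and v = "\<lambda>r j. v r"])
    show "h r \<noteq> h ((r + 2) mod 4)" if "2 * n + 1 = 4" for r using that by presburger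
    show "h r < 5" "v r < 5" for r by (simp_all add: h_def v_def)
  qed (use assms disjoint in auto)
qed

section \<open>The lower bound and the exact values\<close>

lemma q_B_cylinder_attained:
  assumes "3 \<le> k"
  shows "\<exists>c. B_coloring (cylinder k m) c \<and> card (c ` edges (cylinder k m)) = q_B (cylinder k m)"
  by (intro q_B_attained finite_simple_cartesian_product finite_simple_cycle_graph
      finite_simple_path_graph assms)

text \<open>The square on columns 0 and 1 and levels 0 and 1 is rainbow.\<close>

lemma q_B_cylinder_ge_4:
  assumes k: "3 \<le> k" and m: "2 \<le> m"
  shows "4 \<le> q_B (cylinder k m)"
proof -
  let ?E = "edges (cylinder k m)"
  obtain c where c: "B_coloring (cylinder k m) c" "card (c ` ?E) = q_B (cylinder k m)"
    using q_B_cylinder_attained[OF k] by blast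
  let ?l = "[c (hedge k 0 0), c (hedge k 0 1), c (vedge 0 0), c (vedge 1 0)]"
  have "distinct [c (hedge k i j), c (hedge k i (Suc j)), c (vedge i j), c (vedge (Suc i mod k) j)]"
    if "i < k" "Suc j < m" for i j
    using cylinder_coloring_of_B_coloring[OF c(1) k] that unfolding cylinder_coloring_def by blast
  from this[of 0 0] have "distinct ?l" using k m by simp
  then have "card (set ?l) = 4" by (simp only: distinct_card) simp
  moreover have "set ?l \<subseteq> c ` ?E"
    using k m by (auto intro!: imageI hedge_in_cylinder vedge_in_cylinder)
  moreover have "finite ?E"
    by (intro finite_edges finite_simple_cartesian_product finite_simple_cycle_graph
        finite_simple_path_graph k)
  ultimately show ?thesis using c(2) card_mono[of "c ` ?E" "set ?l"] by simp
qed

theorem theorem1p5: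
  fixes m :: nat
  assumes "m \<ge> 2"
  shows "(\<forall>n::nat. n \<ge> 2 \<longrightarrow>
            q_B (cartesian_product (cycle_graph (2 * n)) (path_graph m)) = 4) \<and>
         (\<forall>n::nat. n \<ge> 1 \<longrightarrow>
            (2 \<le> m \<and> m \<le> n \<longrightarrow>
               q_B (cartesian_product (cycle_graph (2 * n + 1)) (path_graph m)) = 4) \<and>
            (m \<ge> n + 1 \<longrightarrow>
               q_B (cartesian_product (cycle_graph (2 * n + 1)) (path_graph m)) = 5))"
proof (intro conjI allI impI)
  fix n :: nat assume n: "2 \<le> n"
  then have "3 \<le> 2 * n" by simp
  from q_B_cylinder_ge_4[OF this assms] q_B_even_cylinder_le[OF n, of m]
  show "q_B (cylinder (2 * n) m) = 4" by simp
next
  fix n :: nat assume n: "1 \<le> n" and "2 \<le> m \<and> m \<le> n"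
  then have "q_B (cylinder (2 * n + 1) m) \<le> 4" by (intro q_B_odd_cylinder_le_4) auto
  with q_B_cylinder_ge_4[OF _ assms, of "2 * n + 1"] n
  show "q_B (cylinder (2 * n + 1) m) = 4" by simp
next
  fix n :: nat assume n: "1 \<le> n" and m: "n + 1 \<le> m"
  have k: "3 \<le> 2 * n + 1" using n by simp
  obtain c where "B_coloring (cylinder (2 * n + 1) m) c"
    "card (c ` edges (cylinder (2 * n + 1) m)) = q_B (cylinder (2 * n + 1) m)"
    using q_B_cylinder_attained[OF k] by blast
  \<comment> \<open>An optimal coloring with exactly four colors is excluded, so between the bounds
    4 and 5 only 5 remains.\<close>
  then have "q_B (cylinder (2 * n + 1) m) \<noteq> 4" using no_four_coloring[OF _ n m] by metis
  with q_B_cylinder_ge_4[OF k assms] q_B_odd_cylinder_le_5[OF n, of m]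
  show "q_B (cylinder (2 * n + 1) m) = 5" by simp
qed

end
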